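(* Let $E$ be a Polish space, let $(\psi_k)_{k\in\mathbb{N}}$ be any sequence of gauge functions on $E$, and let $M\subseteq\mathcal{M}_1^{(\psi_k)}$. Then the following conditions are equivalent: (a) $\mathcal{O}_{(\psi_k)}\cap M=\mathcal{O}_{\rm w}\cap M$, i.e. the relative $(\psi_k)$-weak topology and the relative weak topology on $M$ coincide. (b) $M$ is locally uniformly $(\psi_k)$-integrating. (c) Every weakly compact subset of $M$ is uniformly $(\psi_k)$-integrating. (d) Every sequence in $M$ which converges weakly to an element of $M$ is uniformly $(\psi_k)$-integrating. (e) For every sequence $(\mu_n)_{n\in\mathbb{N}}\subseteq M$ converging weakly to some $\mu_0\in M$, the convergence $\int\psi_k\,d\mu_n\to\int\psi_k\,d\mu_0$ holds for all $k\in\mathbb{N}$.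
   Context: $E$ is a Polish space, $\mathcal{M}_1$ is the set of all Borel probability measures on $E$, and $\mathcal{O}_{\rm w}$ is the weak topology on $\mathcal{M}_1$. A gauge function is a continuous function $\psi:E\to[0,\infty)$. For a sequence $(\psi_k)_{k\in\mathbb{N}}$ of gauge functions, $\mathcal{M}_1^{(\psi_k)}$ is the set of all $\mu\in\mathcal{M}_1$ with $\int\psi_k\,d\mu<\infty$ for every $k$. $\mathcal{C}_{\psi_k}$ is the space of all continuous $f:E\to\mathbb{R}$ with $\sup_{x\in E}|f(x)/(1+\psi_k(x))|<\infty$. The $(\psi_k)$-weak topology $\mathcal{O}_{(\psi_k)}$ on $\mathcal{M}_1^{(\psi_k)}$ is the coarsest topology for which all mappings $\mu\mapsto\int f\,d\mu$, $f\in\mathcal{C}_{\psi_k}$, $k\in\mathbb{N}$, are continuous. A set $M\subseteq\mathcal{M}_1$ is locally uniformly $(\psi_k)$-integrating if for every $\mu\in M$, $\varepsilon>0$ and $k\in\mathbb{N}$ there exist $a>0$ and a weakly open neighborhood $U$ of $\mu$ such that $\int\psi_k\mathbf{1}_{\{\psi_k\ge a\}}\,d\nu\le\varepsilon$ for all $\nu\in M\cap U$. A set $M\subseteq\mathcal{M}_1$ is uniformly $(\psi_k)$-integrating if for every $\varepsilon>0$ and $k\in\mathbb{N}$ there exists $a>0$ such that $\sup_{\mu\in M}\int\psi_k\mathbf{1}_{\{\psi_k\ge a\}}\,d\mu\le\varepsilon$; a sequence is uniformly $(\psi_k)$-integrating if its set of members is. *)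

theory Defs
  imports "HOL-Probability.Probability"
begin

definition prob_measures :: "'a::topological_space measure set" where
  "prob_measures = {\<mu>. prob_space \<mu> \<and> sets \<mu> = sets borel}"

text \<open>The coarsest topology on the carrier \<open>S\<close> for which all maps in \<open>F\<close> are continuous.
  The set \<open>S\<close> itself is added as a generator only so that \<open>S\<close> is the carrier also
  when \<open>F\<close> is empty.\<close>

definition coarsest_topology :: "'b set \<Rightarrow> ('b \<Rightarrow> real) set \<Rightarrow> 'b topology" where
  "coarsest_topology S F =
     topology_generated_by (insert S {{\<mu> \<in> S. \<phi> \<mu> \<in> V} | \<phi> V. \<phi> \<in> F \<and> open V})"

lemma topspace_coarsest_topology: "topspace (coarsest_topology S F) = S"
  unfolding coarsest_topology_def topology_generated_by_topspace by auto

lemma continuous_map_coarsest_topology: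
  assumes "\<phi> \<in> F"
  shows "continuous_map (coarsest_topology S F) euclidean \<phi>"
  unfolding continuous_map_def topspace_coarsest_topology
proof (intro conjI allI impI)
  fix V :: "real set"
  assume "openin euclidean V"
  then have "{\<mu> \<in> S. \<phi> \<mu> \<in> V} \<in> insert S {{\<mu> \<in> S. \<phi> \<mu> \<in> V} | \<phi> V. \<phi> \<in> F \<and> open V}"
    using assms by auto
  then show "openin (coarsest_topology S F) {\<mu> \<in> S. \<phi> \<mu> \<in> V}"
    unfolding coarsest_topology_def by (rule topology_generated_by_Basis)
qed auto

lemma coarsest_topology_coarsest:
  assumes "topspace T = S" "\<And>\<phi>. \<phi> \<in> F \<Longrightarrow> continuous_map T euclidean \<phi>"
    and "openin (coarsest_topology S F) U"
  shows "openin T U"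
proof -
  have "generate_topology_on (insert S {{\<mu> \<in> S. \<phi> \<mu> \<in> V} | \<phi> V. \<phi> \<in> F \<and> open V}) U"
    using assms(3) unfolding coarsest_topology_def openin_topology_generated_by_iff .
  then show ?thesis
  proof (induction rule: generate_topology_on.induct)
    case (Basis s)
    then show ?case
      using assms(1,2) by (auto simp: continuous_map_def)
  qed auto
qed

text \<open>In the two topologies below the integral is the Bochner integral; every integrand that
  occurs is integrable with respect to every measure in the carrier.\<close>

definition weak_topology :: "'a::topological_space measure topology" where
  "weak_topology = coarsest_topology prob_measures
     {\<lambda>\<mu>. \<integral>x. f x \<partial>\<mu> | f. continuous_on UNIV f \<and> bounded (range f)}"

definition gauge_function :: "('a::topological_space \<Rightarrow> real) \<Rightarrow> bool" where
  "gauge_function \<psi> \<longleftrightarrow> continuous_on UNIV \<psi> \<and> (\<forall>x. 0 \<le> \<psi> x)"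

definition prob_measures_gauge ::
    "(nat \<Rightarrow> 'a::topological_space \<Rightarrow> real) \<Rightarrow> 'a measure set" where
  "prob_measures_gauge \<psi> = {\<mu> \<in> prob_measures. \<forall>k. (\<integral>\<^sup>+x. ennreal (\<psi> k x) \<partial>\<mu>) < \<infinity>}"

definition cont_gauge_bounded ::
    "('a::topological_space \<Rightarrow> real) \<Rightarrow> ('a \<Rightarrow> real) set" where
  "cont_gauge_bounded \<psi> =
     {f. continuous_on UNIV f \<and> bdd_above (range (\<lambda>x. \<bar>f x / (1 + \<psi> x)\<bar>))}"

definition gauge_weak_topology ::
    "(nat \<Rightarrow> 'a::topological_space \<Rightarrow> real) \<Rightarrow> 'a measure topology" where
  "gauge_weak_topology \<psi> = coarsest_topology (prob_measures_gauge \<psi>)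
     {\<lambda>\<mu>. \<integral>x. f x \<partial>\<mu> | f k. f \<in> cont_gauge_bounded (\<psi> k)}"

text \<open>The tail integrals below are nonnegative Lebesgue integrals with values in \<open>[0, \<infinity>]\<close>,
  since the two notions are defined for arbitrary sets of probability measures.\<close>

definition locally_uniformly_integrating ::
    "(nat \<Rightarrow> 'a::topological_space \<Rightarrow> real) \<Rightarrow> 'a measure set \<Rightarrow> bool" where
  "locally_uniformly_integrating \<psi> M \<longleftrightarrow>
     (\<forall>\<mu>\<in>M. \<forall>\<epsilon>::real. \<epsilon> > 0 \<longrightarrow> (\<forall>k. \<exists>a::real. a > 0 \<and>
        (\<exists>U. openin weak_topology U \<and> \<mu> \<in> U \<and>
          (\<forall>\<nu>\<in>M \<inter> U.
             (\<integral>\<^sup>+x. ennreal (\<psi> k x) * indicator {y. a \<le> \<psi> k y} x \<partial>\<nu>) \<le> ennreal \<epsilon>))))"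

definition uniformly_integrating ::
    "(nat \<Rightarrow> 'a::topological_space \<Rightarrow> real) \<Rightarrow> 'a measure set \<Rightarrow> bool" where
  "uniformly_integrating \<psi> M \<longleftrightarrow>
     (\<forall>\<epsilon>::real. \<epsilon> > 0 \<longrightarrow> (\<forall>k. \<exists>a::real. a > 0 \<and>
        (SUP \<mu>\<in>M. \<integral>\<^sup>+x. ennreal (\<psi> k x) * indicator {y. a \<le> \<psi> k y} x \<partial>\<mu>) \<le> ennreal \<epsilon>))"

end

theory Submission
  imports Defs
begin

text \<open>
  Splitting \<open>\<psi>\<close> into a bounded continuous truncation and a remainder dominated by the tail integral
  turns small tails into convergence of the integrals of functions of growth \<open>\<psi>\<close>, and conversely.
  To pass from sequences back to neighbourhoods one needs first countability of the weak topology.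
  For this, call \<open>max 0 (q - j * dist x d)\<close> with \<open>d\<close> in a countable dense set, \<open>q\<close> rational and
  \<open>j\<close> natural a tent. There are only countably many finite maxima of tents, and every nonnegative
  bounded continuous \<open>f\<close> is the limit of an increasing sequence of them. Convergence of the integrals
  of these maxima hence gives \<open>liminf\<close> bounds for the integral of \<open>f\<close>, and applying this to
  \<open>B + f\<close> and \<open>B - f\<close> gives weak convergence.
\<close>

section \<open>Initial topologies: generators, continuity and limits\<close>

lemma openin_coarsest_topology:
  assumes "\<phi> \<in> F" "open V"
  shows "openin (coarsest_topology S F) {\<mu> \<in> S. \<phi> \<mu> \<in> V}"
  unfolding coarsest_topology_def
  by (rule topology_generated_by_Basis) (use assms in auto)

text \<open>Continuity into a generated topology need only be tested on generators, and the preimage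
  of the extra generator \<open>S\<close> is the whole space.\<close>

lemma continuous_map_into_coarsest_topology:
  assumes "\<And>x. x \<in> topspace X \<Longrightarrow> g x \<in> S"
    and "\<And>\<phi>. \<phi> \<in> F \<Longrightarrow> continuous_map X euclidean (\<lambda>x. \<phi> (g x))"
  shows "continuous_map X (coarsest_topology S F) g"
  unfolding coarsest_topology_def
proof (rule continuous_on_generated_topo)
  fix U assume "U \<in> insert S {{\<mu> \<in> S. \<phi> \<mu> \<in> V} | \<phi> V. \<phi> \<in> F \<and> open V}"
  then consider "U = S" | \<phi> V where "\<phi> \<in> F" "open V" "U = {\<mu> \<in> S. \<phi> \<mu> \<in> V}"
    by blast
  then show "openin X (g -` U \<inter> topspace X)"
  proof cases
    case 1
    then have "g -` U \<inter> topspace X = topspace X"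
      using assms(1) by auto
    then show ?thesis by simp
  next
    case 2
    then have "g -` U \<inter> topspace X = {x \<in> topspace X. \<phi> (g x) \<in> V}"
      using assms(1) by auto
    then show ?thesis
      using assms(2)[OF 2(1)] 2(2) by (auto simp: continuous_map_def)
  qed
qed (use assms(1) in auto)

text \<open>By induction on how open sets are generated: being eventually inside is kept by finite
  intersections, a union needs only one member containing \<open>l\<close>, and for generators
  \<open>lim\<close> applies.\<close>

lemma limitin_coarsest_topology:
  assumes l: "l \<in> S" and u: "\<And>n. u n \<in> S"
    and lim: "\<And>\<phi>. \<phi> \<in> F \<Longrightarrow> ((\<lambda>n. \<phi> (u n)) \<longlongrightarrow> \<phi> l) A"
  shows "limitin (coarsest_topology S F) u l A"
  unfolding limitin_def topspace_coarsest_topology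
proof (intro conjI allI impI l, elim conjE)
  fix U assume "openin (coarsest_topology S F) U" "l \<in> U"
  then have "generate_topology_on (insert S {{\<mu> \<in> S. \<phi> \<mu> \<in> V} | \<phi> V. \<phi> \<in> F \<and> open V}) U"
    unfolding coarsest_topology_def openin_topology_generated_by_iff by simp
  then show "\<forall>\<^sub>F n in A. u n \<in> U"
    using \<open>l \<in> U\<close>
  proof (induction rule: generate_topology_on.induct)
    case (Int a b)
    then show ?case by (auto intro: eventually_conj)
  next
    case (UN K)
    then obtain k where k: "k \<in> K" "l \<in> k" by blast
    from UN.IH[OF this] show ?case
      by (rule eventually_mono) (use k in blast)
  next
    case (Basis s)
    then consider "s = S" | \<phi> V where "\<phi> \<in> F" "open V" "s = {\<mu> \<in> S. \<phi> \<mu> \<in> V}"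
      by blast
    then show ?case
    proof cases
      case 1
      then show ?thesis using u by simp
    next
      case 2
      then show ?thesis
        using topological_tendstoD[OF lim[OF 2(1)] 2(2)] Basis.prems u by auto
    qed
  qed simp
qed

section \<open>Weak convergence and integrals of bounded continuous functions\<close>

lemma topspace_weak_topology: "topspace weak_topology = prob_measures"
  by (simp add: weak_topology_def topspace_coarsest_topology)

lemma continuous_map_weak_topology:
  fixes f :: "'a::topological_space \<Rightarrow> real"
  assumes "continuous_on UNIV f" "bounded (range f)"
  shows "continuous_map weak_topology euclidean (\<lambda>\<mu>. \<integral>x. f x \<partial>\<mu>)"
  unfolding weak_topology_def
  by (rule continuous_map_coarsest_topology) (use assms in blast)

lemma openin_weak_topology:
  fixes f :: "'a::topological_space \<Rightarrow> real"
  assumes "continuous_on UNIV f" "bounded (range f)" "open V"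
  shows "openin weak_topology {\<mu> \<in> prob_measures. (\<integral>x. f x \<partial>\<mu>) \<in> V}"
  unfolding weak_topology_def
  by (rule openin_coarsest_topology[where \<phi> = "\<lambda>\<mu>. \<integral>x. f x \<partial>\<mu>"]) (use assms in blast)+

lemma limitin_weak_topology_integral:
  fixes f :: "'a::topological_space \<Rightarrow> real"
  assumes "limitin weak_topology u l A" "continuous_on UNIV f" "bounded (range f)"
  shows "((\<lambda>n. \<integral>x. f x \<partial>u n) \<longlongrightarrow> (\<integral>x. f x \<partial>l)) A"
  using continuous_map_limit[OF continuous_map_weak_topology[OF assms(2,3)] assms(1)]
  by (simp add: o_def)

lemma limitin_weak_topologyI:
  assumes "l \<in> prob_measures" "\<And>n. u n \<in> prob_measures"
    and "\<And>f :: 'a::topological_space \<Rightarrow> real. continuous_on UNIV f \<Longrightarrow> bounded (range f) \<Longrightarrow>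
      ((\<lambda>n. \<integral>x. f x \<partial>u n) \<longlongrightarrow> (\<integral>x. f x \<partial>l)) A"
  shows "limitin weak_topology u l A"
  unfolding weak_topology_def
  by (rule limitin_coarsest_topology) (use assms in auto)

lemma borel_measurable_prob_measures:
  fixes f :: "'a::topological_space \<Rightarrow> real"
  assumes "\<mu> \<in> prob_measures" "continuous_on UNIV f"
  shows "f \<in> borel_measurable \<mu>"
  using assms borel_measurable_continuous_onI[OF assms(2)]
  by (simp add: prob_measures_def cong: measurable_cong_sets)

lemma integrable_bounded_prob_measures:
  fixes f :: "'a::topological_space \<Rightarrow> real"
  assumes "\<mu> \<in> prob_measures" "continuous_on UNIV f" "bounded (range f)"
  shows "integrable \<mu> f"
proof -
  from assms(1) interpret prob_space \<mu> by (simp add: prob_measures_def)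
  from assms(3) obtain B where "\<And>x. norm (f x) \<le> B"
    unfolding bounded_iff by auto
  then show ?thesis
    by (intro integrable_const_bound[where B = B] borel_measurable_prob_measures[OF assms(1,2)]) simp
qed

subsection \<open>Sequential neighbourhood bases of the weak topology\<close>

text \<open>\<open>SOME\<close> fixes one countable dense set of centres, so that with rational
  peaks and natural slopes the family stays countable. For \<open>j > 0\<close> the cut-off at zero
  confines the positive part to distance less than \<open>q / j\<close> from the centre.\<close>

definition tents :: "('a::polish_space \<Rightarrow> real) set" where
  "tents = (\<lambda>(d, q, j) x. max 0 (of_rat q - real j * dist x d)) `
     ((SOME D. countable D \<and> (\<forall>X. open X \<longrightarrow> X \<noteq> {} \<longrightarrow> (\<exists>d\<in>D. d \<in> X))) \<times> UNIV \<times> UNIV)"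

text \<open>Finite families are coded as lists because the lists over a countable set are again
  countable. Starting from the zero function gives the empty list a value and keeps every maximum
  nonnegative.\<close>

definition max_fold :: "('a \<Rightarrow> real) list \<Rightarrow> 'a \<Rightarrow> real" where
  "max_fold hs = fold (\<lambda>h g x. max (g x) (h x)) hs (\<lambda>x. 0)"

lemma max_fold_simps:
  "max_fold [] = (\<lambda>x. 0)"
  "max_fold (hs @ [h]) = (\<lambda>x. max (max_fold hs x) (h x))"
  by (simp_all add: max_fold_def)

lemma countable_tents: "countable (tents :: ('a::polish_space \<Rightarrow> real) set)"
  unfolding tents_def
  by (intro countable_image countable_SIGMA) (use someI_ex[OF countable_dense_exists] in auto)

lemma tents_bounded:
  assumes "h \<in> tents"
  shows "continuous_on UNIV h" "\<And>x. 0 \<le> h x" "\<exists>q. \<forall>x. h x \<le> q"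
proof -
  obtain d q j where h: "h = (\<lambda>x. max 0 (of_rat q - real j * dist x d))"
    using assms unfolding tents_def by auto
  show "continuous_on UNIV h" "\<And>x. 0 \<le> h x"
    unfolding h by (auto intro!: continuous_intros)
  have "h x \<le> max 0 (of_rat q)" for x
    unfolding h by (intro max.mono) simp_all
  then show "\<exists>q. \<forall>x. h x \<le> q" by blast
qed

text \<open>By continuity \<open>f\<close> exceeds some rational \<open>q > r\<close> on a ball
  around \<open>x\<close>. A cone of height \<open>q\<close> centred close to \<open>x\<close> fits
  below \<open>f\<close> if it is steep enough to vanish outside that ball, where
  \<open>f \<ge> 0\<close> suffices.\<close>

lemma tent_between:
  fixes f :: "'a::polish_space \<Rightarrow> real"
  assumes f: "continuous_on UNIV f" "\<And>x. 0 \<le> f x" and r: "0 \<le> r" "r < f x"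
  obtains h where "h \<in> tents" "\<And>y. h y \<le> f y" "r < h x"
proof -
  define D :: "'a set" where
    "D = (SOME D. countable D \<and> (\<forall>X. open X \<longrightarrow> X \<noteq> {} \<longrightarrow> (\<exists>d\<in>D. d \<in> X)))"
  have "countable D \<and> (\<forall>X. open X \<longrightarrow> X \<noteq> {} \<longrightarrow> (\<exists>d\<in>D. d \<in> X))"
    unfolding D_def by (rule someI_ex[OF countable_dense_exists])
  then have D: "\<exists>d\<in>D. d \<in> X" if "open X" "X \<noteq> {}" for X
    using that by simp
  obtain q where q: "r < of_rat q" "of_rat q < f x"
    using of_rat_dense[OF r(2)] by blast
  have "open {y. of_rat q < f y}"
    by (rule open_Collect_less) (use f in auto)
  then obtain \<delta> where \<delta>: "\<delta> > 0" "\<And>y. dist y x < \<delta> \<Longrightarrow> of_rat q < f y"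
    using q(2) unfolding open_dist by auto
  \<comment> \<open>This slope brings a cone of height \<open>q\<close> down to zero within distance
    \<open>\<delta> / 2\<close>.\<close>
  obtain j :: nat where j: "2 * of_rat q / \<delta> < real j"
    using reals_Archimedean2 by blast
  have "0 \<le> 2 * of_rat q / \<delta>"
    by (intro divide_nonneg_pos mult_nonneg_nonneg) (use r q \<delta>(1) in linarith)+
  then have j0: "0 < real j" using j by linarith
  \<comment> \<open>The first bound puts every point outside the ball of radius
    \<open>\<delta>\<close> at distance at least \<open>\<delta> / 2\<close> from the centre
    \<open>d\<close>; the second makes the loss of height at \<open>x\<close> smaller than
    \<open>q - r\<close>.\<close>
  define e where "e = min (\<delta> / 2) ((of_rat q - r) / j)"
  have "e > 0" using \<delta>(1) q(1) j0 by (simp add: e_def)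
  then have "\<exists>d\<in>D. d \<in> ball x e" by (intro D) simp_all
  then obtain d where "d \<in> D" "dist x d < e" by auto
  then have d: "d \<in> D" "dist x d < \<delta> / 2" "dist x d < (of_rat q - r) / j"
    by (simp_all add: e_def)
  define h where "h = (\<lambda>y. max 0 (of_rat q - real j * dist y d))"
  have "h \<in> tents"
    unfolding tents_def D_def[symmetric] h_def by (rule image_eqI[of _ _ "(d, q, j)"]) (use d(1) in simp_all)
  moreover have "h y \<le> f y" for y
  proof (cases "dist y x < \<delta>")
    case True
    have "0 \<le> j * dist y d" by simp
    then have "h y \<le> of_rat q"
      unfolding h_def by (intro max.boundedI) (use r(1) q(1) in linarith)+
    then show ?thesis using \<delta>(2)[OF True] by simp
  next
    case False
    then have "\<delta> / 2 \<le> dist y d"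
      using d(2) dist_triangle[of y x d] by (simp add: dist_commute)
    then have "j * (\<delta> / 2) \<le> j * dist y d"
      using j0 by simp
    moreover have "of_rat q \<le> j * (\<delta> / 2)"
      using j \<delta>(1) by (simp add: field_simps)
    ultimately show ?thesis using f(2)[of y] unfolding h_def by simp
  qed
  moreover have "r < h x"
  proof -
    have "j * dist x d < of_rat q - r"
      using d(3) j0 by (simp add: field_simps)
    then show ?thesis unfolding h_def by simp
  qed
  ultimately show ?thesis using that by blast
qed

lemma max_fold_tents:
  assumes "set hs \<subseteq> tents"
  shows "continuous_on UNIV (max_fold hs)" "bounded (range (max_fold hs))"
proof -
  \<comment> \<open>Nonnegativity is carried along because it turns the upper bound into a bound on
    the absolute value.\<close>
  have "continuous_on UNIV (max_fold hs) \<and> (\<forall>x. 0 \<le> max_fold hs x) \<and> (\<exists>q. \<forall>x. max_fold hs x \<le> q)"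
    using assms
  proof (induction hs rule: rev_induct)
    case Nil
    then show ?case by (auto simp: max_fold_simps)
  next
    case (snoc h hs)
    then obtain p q where "\<And>x. max_fold hs x \<le> p" "\<And>x. h x \<le> q"
      using tents_bounded(3)[of h] by auto
    then have "max_fold (hs @ [h]) x \<le> max p q" for x
      unfolding max_fold_simps by (intro max.mono)
    moreover have "continuous_on UNIV (max_fold (hs @ [h]))"
      unfolding max_fold_simps using snoc tents_bounded(1)[of h] by (intro continuous_on_max) auto
    moreover have "0 \<le> max_fold (hs @ [h]) x" for x
      using snoc by (auto simp: max_fold_simps le_max_iff_disj)
    ultimately show ?case by blast
  qed
  then show "continuous_on UNIV (max_fold hs)" "bounded (range (max_fold hs))"
    by (auto intro: boundedI simp: bounded_iff)
qed

text \<open>The maxima of the first \<open>n\<close> tents lying below \<open>f\<close> increase to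
  \<open>f\<close>, since by \<open>tent_between\<close> some such tent passes any given nonnegative
  value below \<open>f x\<close>. Dominated convergence, with \<open>f\<close> itself as the bound,
  carries this over to the integrals.\<close>

lemma max_fold_tents_integral_approx:
  fixes f :: "'a::polish_space \<Rightarrow> real"
  assumes \<mu>: "\<mu> \<in> prob_measures"
    and f: "continuous_on UNIV f" "bounded (range f)" "\<And>x. 0 \<le> f x"
    and c: "c < (\<integral>x. f x \<partial>\<mu>)"
  obtains hs where "set hs \<subseteq> tents" "\<And>x. max_fold hs x \<le> f x" "c < (\<integral>x. max_fold hs x \<partial>\<mu>)"
proof (cases "\<exists>h\<in>tents. \<forall>x. h x \<le> f x")
  \<comment> \<open>With nothing to enumerate, \<open>tent_between\<close> for \<open>r = 0\<close>
    forces \<open>f\<close> to vanish, and the empty list does.\<close>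
  case False
  have "f x \<le> 0" for x
  proof (rule ccontr)
    assume "\<not> f x \<le> 0"
    then obtain h where "h \<in> tents" "\<And>y. h y \<le> f y"
      using tent_between[OF f(1,3), of 0 x] by auto
    with False show False by blast
  qed
  then have "f = (\<lambda>x. 0)" using f(3) by (auto intro: antisym)
  then show ?thesis using that[of "[]"] c by (simp add: max_fold_simps)
next
  case True
  define H where "H = {h\<in>tents. \<forall>x. h x \<le> f x}"
  define t where "t = from_nat_into H"
  have "H \<noteq> {}" "countable H"
    using True countable_tents unfolding H_def by (auto intro: countable_subset)
  then have range_t: "range t = H"
    unfolding t_def by (rule range_from_nat_into)
  define g where "g n = max_fold (map t [0..<n])" for n
  have g_Suc: "g (Suc n) x = max (g n x) (t n x)" for n x
    unfolding g_def by (simp add: max_fold_simps)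
  have tH: "t n \<in> tents" "t n x \<le> f x" for n x
    using range_t unfolding H_def by blast+
  have g_le: "g n x \<le> f x" for n x
  proof (induction n)
    case 0
    then show ?case using f(3) by (simp add: g_def max_fold_simps)
  qed (use tH in \<open>simp add: g_Suc\<close>)
  have g_nonneg: "0 \<le> g n x" for n x
    by (induction n) (auto simp: g_Suc g_def[of 0] max_fold_simps le_max_iff_disj)
  have g_mono: "g m x \<le> g n x" if "m \<le> n" for m n x
    using that by (rule lift_Suc_mono_le[of "\<lambda>n. g n x", rotated]) (simp add: g_Suc)
  have g_lim: "(\<lambda>n. g n x) \<longlonglongrightarrow> f x" for x
  proof (rule order_tendstoI)
    fix r assume r: "r < f x"
    show "\<forall>\<^sub>F n in sequentially. r < g n x"
    \<comment> \<open>\<open>tent_between\<close> asks for \<open>0 \<le> r\<close>; for negative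
      \<open>r\<close> the nonnegativity of \<open>g n\<close> is enough.\<close>
    proof (cases "0 \<le> r")
      case True
      obtain h where h: "h \<in> tents" "\<And>y. h y \<le> f y" "r < h x"
        using tent_between[OF f(1,3) True r] by blast
      then obtain m where "h = t m"
        using range_t unfolding H_def by blast
      \<comment> \<open>\<open>g n\<close> uses only the tents with index below \<open>n\<close>, so
        \<open>t m\<close> enters at \<open>Suc m\<close>.\<close>
      then have "r < g (Suc m) x" using h by (simp add: g_Suc less_max_iff_disj)
      then have "r < g n x" if "Suc m \<le> n" for n
        by (rule less_le_trans[OF _ g_mono[OF that]])
      then show ?thesis by (rule eventually_sequentiallyI)
    next
      case False
      then have "r < g n x" for n using g_nonneg[where n = n and x = x] by linarith
      then show ?thesis by simp
    qed
  next
    fix r assume "f x < r"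
    then have "g n x < r" for n using g_le[where n = n and x = x] by linarith
    then show "\<forall>\<^sub>F n in sequentially. g n x < r" by simp
  qed
  have hs: "set (map t [0..<n]) \<subseteq> tents" for n using tH by auto
  have "(\<lambda>n. \<integral>x. g n x \<partial>\<mu>) \<longlonglongrightarrow> (\<integral>x. f x \<partial>\<mu>)"
  proof (rule integral_dominated_convergence)
    show "integrable \<mu> f"
      by (rule integrable_bounded_prob_measures[OF \<mu> f(1,2)])
    show "f \<in> borel_measurable \<mu>"
      by (rule borel_measurable_prob_measures[OF \<mu> f(1)])
    show "g n \<in> borel_measurable \<mu>" for n
      unfolding g_def by (rule borel_measurable_prob_measures[OF \<mu> max_fold_tents(1)[OF hs]])
    show "AE x in \<mu>. (\<lambda>n. g n x) \<longlonglongrightarrow> f x"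
      using g_lim by simp
    show "AE x in \<mu>. norm (g n x) \<le> f x" for n
      using g_le g_nonneg by simp
  qed
  then have "\<forall>\<^sub>F n in sequentially. c < (\<integral>x. g n x \<partial>\<mu>)"
    by (rule order_tendstoD(1)[OF _ c])
  then obtain n where "c < (\<integral>x. g n x \<partial>\<mu>)"
    unfolding eventually_sequentially by auto
  then show ?thesis
    using g_le unfolding g_def by (intro that[OF hs])
qed

lemma limitin_weak_topology_tents:
  fixes \<mu> :: "'a::polish_space measure"
  assumes \<mu>: "\<mu> \<in> prob_measures" and \<nu>: "\<And>n. \<nu> n \<in> prob_measures"
    and lim: "\<And>hs. set hs \<subseteq> tents \<Longrightarrow>
      ((\<lambda>n. \<integral>x. max_fold hs x \<partial>\<nu> n) \<longlongrightarrow> (\<integral>x. max_fold hs x \<partial>\<mu>)) A"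
  shows "limitin weak_topology \<nu> \<mu> A"
proof (rule limitin_weak_topologyI[OF \<mu> \<nu>])
  \<comment> \<open>Lower semicontinuity: one minorant \<open>max_fold hs\<close>, chosen for
    \<open>\<mu>\<close> and independent of \<open>n\<close>, has convergent integrals that bound
    those of \<open>f\<close> from below.\<close>
  have *: "\<forall>\<^sub>F n in A. c < (\<integral>x. f x \<partial>\<nu> n)"
    if f: "continuous_on UNIV f" "bounded (range f)" "\<And>x. 0 \<le> f x"
      and c: "c < (\<integral>x. f x \<partial>\<mu>)" for f :: "'a \<Rightarrow> real" and c
  proof -
    obtain hs where hs: "set hs \<subseteq> tents" "\<And>x. max_fold hs x \<le> f x" "c < (\<integral>x. max_fold hs x \<partial>\<mu>)"
      using max_fold_tents_integral_approx[OF \<mu> f c] by blast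
    have "(\<integral>x. max_fold hs x \<partial>\<nu> n) \<le> (\<integral>x. f x \<partial>\<nu> n)" for n
      by (intro integral_mono integrable_bounded_prob_measures[OF \<nu>] max_fold_tents hs f)
    with order_tendstoD(1)[OF lim[OF hs(1)] hs(3)] show ?thesis
      by (auto elim!: eventually_mono intro: less_le_trans)
  qed
  fix f :: "'a \<Rightarrow> real" assume f: "continuous_on UNIV f" "bounded (range f)"
  then obtain B where B: "\<And>x. \<bar>f x\<bar> \<le> B" unfolding bounded_iff by auto
  \<comment> \<open>Total mass one makes the added constant the same for all measures. The factor
    \<open>s\<close> is later \<open>1\<close> for the lower and \<open>-1\<close> for the upper
    bound.\<close>
  have shift: "(\<integral>x. B + s * f x \<partial>\<rho>) = B + s * (\<integral>x. f x \<partial>\<rho>)" if "\<rho> \<in> prob_measures" for \<rho> s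
  proof -
    from that interpret prob_space \<rho> by (simp add: prob_measures_def)
    show ?thesis
      using integrable_bounded_prob_measures[OF that f] by (simp add: prob_space)
  qed
  have cont: "continuous_on UNIV (\<lambda>x. B + s * f x)" for s
    by (intro continuous_intros f)
  have bdd: "bounded (range (\<lambda>x. B + s * f x))" for s
    unfolding bounded_iff
  proof (intro exI ballI)
    fix y assume "y \<in> range (\<lambda>x. B + s * f x)"
    then obtain x where "y = B + s * f x" by blast
    then show "norm y \<le> \<bar>B\<bar> + \<bar>s\<bar> * B"
      using mult_left_mono[OF B[of x] abs_ge_zero[of s]] by (simp add: abs_mult flip: abs_mult)
  qed
  \<comment> \<open>The redundant-looking \<open>1 *\<close> keeps the shape
    \<open>B + s * f x\<close> of \<open>shift\<close>, \<open>cont\<close> and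
    \<open>bdd\<close>.\<close>
  have nonneg: "0 \<le> B + 1 * f x" "0 \<le> B + (-1) * f x" for x
    using B[of x] by auto
  show "((\<lambda>n. \<integral>x. f x \<partial>\<nu> n) \<longlongrightarrow> (\<integral>x. f x \<partial>\<mu>)) A"
  proof (rule order_tendstoI)
    fix c assume "c < (\<integral>x. f x \<partial>\<mu>)"
    then have "B + c < (\<integral>x. B + 1 * f x \<partial>\<mu>)" by (simp only: shift[OF \<mu>])
    from *[OF cont bdd nonneg(1) this] show "\<forall>\<^sub>F n in A. c < (\<integral>x. f x \<partial>\<nu> n)"
      by (simp only: shift[OF \<nu>]) simp
  next
    fix c assume "(\<integral>x. f x \<partial>\<mu>) < c"
    then have "B - c < (\<integral>x. B + (-1) * f x \<partial>\<mu>)" by (simp only: shift[OF \<mu>])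
    from *[OF cont bdd nonneg(2) this] show "\<forall>\<^sub>F n in A. (\<integral>x. f x \<partial>\<nu> n) < c"
      by (simp only: shift[OF \<nu>]) simp
  qed
qed

text \<open>Enumerate the finite maxima of tents as \<open>h i\<close> and let \<open>U n\<close>
  fix the integrals of \<open>h 0\<close>, ..., \<open>h n\<close> up to \<open>1 / (n + 1)\<close>.
  A sequence with \<open>\<nu> n\<close> in \<open>U n\<close> then has convergent integrals for
  every \<open>h i\<close>, which is enough by \<open>limitin_weak_topology_tents\<close>.\<close>

lemma weak_topology_sequential_base:
  fixes \<mu> :: "'a::polish_space measure"
  assumes \<mu>: "\<mu> \<in> prob_measures"
  obtains U where "\<And>n. openin weak_topology (U n)" "\<And>n. \<mu> \<in> U n"
    "\<And>\<nu>. (\<And>n::nat. \<nu> n \<in> U n) \<Longrightarrow> limitin weak_topology \<nu> \<mu> sequentially"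
proof -
  define h :: "nat \<Rightarrow> 'a \<Rightarrow> real" where "h i = max_fold (from_nat_into (lists tents) i)" for i
  have L: "lists tents \<noteq> {}" "countable (lists tents :: ('a \<Rightarrow> real) list set)"
    using countable_tents by auto
  define U where "U n = {\<nu> \<in> prob_measures. \<forall>i\<le>n. (\<integral>x. h i x \<partial>\<nu>) \<in> ball (\<integral>x. h i x \<partial>\<mu>) (1 / Suc n)}"
    for n :: nat
  have set_h: "set (from_nat_into (lists tents) i) \<subseteq> (tents :: ('a \<Rightarrow> real) set)" for i
    using from_nat_into[OF L(1), of i] by auto
  show ?thesis
  proof (rule that)
    fix n :: nat
    have "U n = (\<Inter>i\<le>n. {\<nu> \<in> prob_measures. (\<integral>x. h i x \<partial>\<nu>) \<in> ball (\<integral>x. h i x \<partial>\<mu>) (1 / Suc n)})"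
      unfolding U_def by auto
    also have "openin weak_topology \<dots>"
      unfolding h_def
      by (intro openin_INT2 openin_weak_topology max_fold_tents set_h) auto
    finally show "openin weak_topology (U n)" .
    show "\<mu> \<in> U n" using \<mu> by (simp add: U_def)
  next
    fix \<nu> :: "nat \<Rightarrow> 'a measure" assume \<nu>: "\<And>n. \<nu> n \<in> U n"
    show "limitin weak_topology \<nu> \<mu> sequentially"
    proof (rule limitin_weak_topology_tents[OF \<mu>])
      show "\<nu> n \<in> prob_measures" for n using \<nu>[of n] by (simp add: U_def)
      fix hs :: "('a \<Rightarrow> real) list" assume "set hs \<subseteq> tents"
      then have "hs \<in> range (from_nat_into (lists tents))"
        unfolding range_from_nat_into[OF L] by auto
      then obtain i where i: "max_fold hs = h i" unfolding h_def by blast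
      show "(\<lambda>n. \<integral>x. max_fold hs x \<partial>\<nu> n) \<longlonglongrightarrow> (\<integral>x. max_fold hs x \<partial>\<mu>)"
        unfolding i
      proof (rule LIM_zero_cancel, rule Lim_null_comparison)
        \<comment> \<open>The integral of \<open>h i\<close> is controlled by \<open>U n\<close>
          from \<open>n = i\<close> onwards.\<close>
        show "\<forall>\<^sub>F n in sequentially. norm ((\<integral>x. h i x \<partial>\<nu> n) - (\<integral>x. h i x \<partial>\<mu>)) \<le> 1 / real (Suc n)"
          using \<nu> by (intro eventually_sequentiallyI[of i])
            (force simp: U_def dist_real_def abs_minus_commute)
      qed (rule LIMSEQ_Suc[OF lim_1_over_n])
    qed
  qed
qed

subsection \<open>Tail integrals\<close>

text \<open>A real value permits subtraction and linear arithmetic; for integrable gauges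
  \<open>nn_tail_integral\<close> identifies it with the \<open>[0, \<infinity>]\<close>-valued
  tail.\<close>

definition tail_integral :: "('a::topological_space \<Rightarrow> real) \<Rightarrow> real \<Rightarrow> 'a measure \<Rightarrow> real" where
  "tail_integral \<psi> a \<mu> = (\<integral>x. \<psi> x * indicator {y. a \<le> \<psi> y} x \<partial>\<mu>)"

lemma integrable_gauge:
  assumes "gauge_function (\<psi> k)" "\<mu> \<in> prob_measures_gauge \<psi>"
  shows "integrable \<mu> (\<psi> k)"
proof (rule integrableI_nonneg)
  show "\<psi> k \<in> borel_measurable \<mu>"
    using assms
    by (intro borel_measurable_prob_measures) (auto simp: gauge_function_def prob_measures_gauge_def)
qed (use assms in \<open>auto simp: gauge_function_def prob_measures_gauge_def\<close>)

context
  fixes \<psi> :: "'a::topological_space \<Rightarrow> real" and \<mu> :: "'a measure"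
  assumes gauge: "gauge_function \<psi>" and \<mu>: "\<mu> \<in> prob_measures" and int: "integrable \<mu> \<psi>"
begin

lemma integrable_tail: "integrable \<mu> (\<lambda>x. \<psi> x * indicator {y. a \<le> \<psi> y} x)"
proof (rule integrable_real_mult_indicator[OF _ int])
  have "closed {y. a \<le> \<psi> y}"
    using gauge by (intro closed_Collect_le) (auto simp: gauge_function_def)
  then show "{y. a \<le> \<psi> y} \<in> sets \<mu>"
    using \<mu> by (simp add: prob_measures_def)
qed

lemma nn_tail_integral:
  "(\<integral>\<^sup>+x. ennreal (\<psi> x) * indicator {y. a \<le> \<psi> y} x \<partial>\<mu>) = ennreal (tail_integral \<psi> a \<mu>)"
proof -
  have "(\<integral>\<^sup>+x. ennreal (\<psi> x) * indicator {y. a \<le> \<psi> y} x \<partial>\<mu>) =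
      (\<integral>\<^sup>+x. ennreal (\<psi> x * indicator {y. a \<le> \<psi> y} x) \<partial>\<mu>)"
    by (intro nn_integral_cong) (simp split: split_indicator)
  also have "\<dots> = ennreal (tail_integral \<psi> a \<mu>)"
    unfolding tail_integral_def
    using gauge by (intro nn_integral_eq_integral integrable_tail) (simp add: gauge_function_def)
  finally show ?thesis .
qed

lemma tail_integral_antimono:
  assumes "a \<le> b"
  shows "tail_integral \<psi> b \<mu> \<le> tail_integral \<psi> a \<mu>"
  unfolding tail_integral_def
  by (intro integral_mono integrable_tail)
    (use gauge assms in \<open>auto simp: gauge_function_def split: split_indicator\<close>)

text \<open>At each point the tail integrand is zero once the level exceeds \<open>\<psi> x\<close>,
  and \<open>\<psi>\<close> dominates all of them.\<close>

lemma tail_integral_small: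
  assumes "\<epsilon> > 0"
  obtains a where "a > 0" "tail_integral \<psi> a \<mu> \<le> \<epsilon>"
proof -
  have "(\<lambda>n. tail_integral \<psi> (real n) \<mu>) \<longlonglongrightarrow> (\<integral>x. 0 \<partial>\<mu>)"
    unfolding tail_integral_def
  proof (rule integral_dominated_convergence)
    show "(\<lambda>x. \<psi> x * indicator {y. real n \<le> \<psi> y} x) \<in> borel_measurable \<mu>" for n
      by (rule borel_measurable_integrable[OF integrable_tail])
    have "(\<lambda>n. \<psi> x * indicator {y. real n \<le> \<psi> y} x) \<longlonglongrightarrow> 0" for x
    proof -
      obtain N :: nat where "\<psi> x < real N" using reals_Archimedean2 by blast
      then have "\<psi> x * indicator {y. real n \<le> \<psi> y} x = 0" if "N \<le> n" for n
        using that by (simp split: split_indicator)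
      then show ?thesis
        by (intro tendsto_eventually eventually_sequentiallyI)
    qed
    then show "AE x in \<mu>. (\<lambda>n. \<psi> x * indicator {y. real n \<le> \<psi> y} x) \<longlonglongrightarrow> 0"
      by simp
    show "AE x in \<mu>. norm (\<psi> x * indicator {y. real n \<le> \<psi> y} x) \<le> \<psi> x" for n
      using gauge by (auto simp: gauge_function_def split: split_indicator)
  qed (use int in simp_all)
  then have "\<forall>\<^sub>F n in sequentially. tail_integral \<psi> (real n) \<mu> < \<epsilon>"
    using assms by (intro order_tendstoD(2)[where y = 0]) simp_all
  \<comment> \<open>Passing to \<open>Suc n\<close> makes the level positive.\<close>
  then obtain n where "tail_integral \<psi> (real (Suc n)) \<mu> < \<epsilon>"
    unfolding eventually_sequentially by (meson le_SucI order_refl)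
  then show ?thesis by (intro that[of "real (Suc n)"]) simp_all
qed

text \<open>The excess integrates the positive part of \<open>\<psi> - a\<close>, which is at least
  \<open>\<psi> / 2\<close> where \<open>\<psi> \<ge> 2 * a\<close>, and at most
  \<open>\<psi>\<close> where \<open>\<psi> \<ge> a\<close> and zero elsewhere. Unlike the tail it
  has no jump: \<open>min \<psi> a\<close> is bounded and continuous, hence accessible to weak
  convergence.\<close>

lemma tail_integral_le_excess:
  assumes "a > 0"
  shows "tail_integral \<psi> (2 * a) \<mu> \<le> 2 * ((\<integral>x. \<psi> x \<partial>\<mu>) - (\<integral>x. min (\<psi> x) a \<partial>\<mu>))"
    and "(\<integral>x. \<psi> x \<partial>\<mu>) - (\<integral>x. min (\<psi> x) a \<partial>\<mu>) \<le> tail_integral \<psi> a \<mu>"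
proof -
  from \<mu> interpret prob_space \<mu> by (simp add: prob_measures_def)
  have int_min: "integrable \<mu> (\<lambda>x. min (\<psi> x) a)"
    by (intro integrable_min int) simp
  have int_excess: "integrable \<mu> (\<lambda>x. \<psi> x - min (\<psi> x) a)"
    by (intro Bochner_Integration.integrable_diff int int_min)
  have excess: "(\<integral>x. \<psi> x \<partial>\<mu>) - (\<integral>x. min (\<psi> x) a \<partial>\<mu>) = (\<integral>x. \<psi> x - min (\<psi> x) a \<partial>\<mu>)"
    using int int_min by simp
  have nonneg: "0 \<le> \<psi> x" for x
    using gauge by (simp add: gauge_function_def)
  have "tail_integral \<psi> (2 * a) \<mu> \<le> (\<integral>x. 2 * (\<psi> x - min (\<psi> x) a) \<partial>\<mu>)"
    unfolding tail_integral_def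
    by (intro integral_mono integrable_tail integrable_mult_right int_excess)
      (use nonneg assms in \<open>auto simp: min_def split: split_indicator\<close>)
  then show "tail_integral \<psi> (2 * a) \<mu> \<le> 2 * ((\<integral>x. \<psi> x \<partial>\<mu>) - (\<integral>x. min (\<psi> x) a \<partial>\<mu>))"
    unfolding excess integral_mult_right_zero .
  show "(\<integral>x. \<psi> x \<partial>\<mu>) - (\<integral>x. min (\<psi> x) a \<partial>\<mu>) \<le> tail_integral \<psi> a \<mu>"
    unfolding excess tail_integral_def
    by (intro integral_mono integrable_tail int_excess)
      (use nonneg assms in \<open>auto simp: min_def split: split_indicator\<close>)
qed

text \<open>Where \<open>\<psi> < a\<close> the cut at height \<open>C * (1 + a)\<close> leaves
  \<open>f\<close> unchanged. Where \<open>\<psi> \<ge> a \<ge> 1\<close> the error is at most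
  \<open>\<bar>f\<bar> \<le> C * (1 + \<psi>) \<le> 2 * C * \<psi>\<close>.\<close>

lemma truncation_error:
  assumes f: "continuous_on UNIV f" "\<And>x. \<bar>f x\<bar> \<le> C * (1 + \<psi> x)" and C: "C \<ge> 0" and a: "a \<ge> 1"
  shows "\<bar>(\<integral>x. f x \<partial>\<mu>) - (\<integral>x. max (- (C * (1 + a))) (min (C * (1 + a)) (f x)) \<partial>\<mu>)\<bar>
    \<le> 2 * C * tail_integral \<psi> a \<mu>"
proof -
  from \<mu> interpret prob_space \<mu> by (simp add: prob_measures_def)
  define g where "g = (\<lambda>x. max (- (C * (1 + a))) (min (C * (1 + a)) (f x)))"
  have nonneg: "0 \<le> \<psi> x" for x
    using gauge by (simp add: gauge_function_def)
  have int_f: "integrable \<mu> f"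
  proof (rule Bochner_Integration.integrable_bound)
    show "integrable \<mu> (\<lambda>x. C * (1 + \<psi> x))" using int by simp
    show "f \<in> borel_measurable \<mu>" by (rule borel_measurable_prob_measures[OF \<mu> f(1)])
    have "norm (f x) \<le> norm (C * (1 + \<psi> x))" for x
      using f(2)[of x] by simp
    then show "AE x in \<mu>. norm (f x) \<le> norm (C * (1 + \<psi> x))" by simp
  qed
  have int_g: "integrable \<mu> g"
    unfolding g_def by (intro integrable_max integrable_min int_f) simp_all
  have le: "\<bar>f x - g x\<bar> \<le> 2 * C * (\<psi> x * indicator {y. a \<le> \<psi> y} x)" for x
  proof (cases "a \<le> \<psi> x")
    case True
    have "0 \<le> C * (1 + a)" using C a by simp
    then have "\<bar>f x - g x\<bar> \<le> \<bar>f x\<bar>" unfolding g_def by linarith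
    also have "\<dots> \<le> C * (1 + \<psi> x)" by (rule f)
    also have "\<dots> \<le> C * (2 * \<psi> x)" using True a C by (intro mult_left_mono) auto
    finally show ?thesis using True by simp
  next
    case False
    then have "C * (1 + \<psi> x) \<le> C * (1 + a)" using C by (intro mult_left_mono) auto
    then have "\<bar>f x\<bar> \<le> C * (1 + a)" using f(2)[of x] by linarith
    then have "f x = g x" unfolding g_def by linarith
    then show ?thesis using False by simp
  qed
  have "\<bar>(\<integral>x. f x \<partial>\<mu>) - (\<integral>x. g x \<partial>\<mu>)\<bar> = \<bar>\<integral>x. f x - g x \<partial>\<mu>\<bar>"
    using int_f int_g by simp
  also have "\<dots> \<le> (\<integral>x. \<bar>f x - g x\<bar> \<partial>\<mu>)" by (rule integral_abs_bound)
  also have "\<dots> \<le> (\<integral>x. 2 * C * (\<psi> x * indicator {y. a \<le> \<psi> y} x) \<partial>\<mu>)"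
    by (intro integral_mono le integrable_mult_right integrable_tail integrable_abs
        Bochner_Integration.integrable_diff int_f int_g)
  also have "\<dots> = 2 * C * tail_integral \<psi> a \<mu>"
    unfolding tail_integral_def by simp
  finally show ?thesis unfolding g_def .
qed

end

text \<open>Both integrals in the excess over \<open>a\<close> converge, so a small excess of the
  limit makes the tails at level \<open>2 * a\<close> small for all large \<open>n\<close>. The
  finitely many other members have small tails individually.\<close>

lemma tail_integral_uniformly_small:
  fixes \<psi> :: "'a::topological_space \<Rightarrow> real"
  assumes gauge: "gauge_function \<psi>"
    and \<mu>: "\<And>n. \<mu> n \<in> prob_measures" "\<And>n. integrable (\<mu> n) \<psi>"
    and \<mu>0: "\<mu>0 \<in> prob_measures" "integrable \<mu>0 \<psi>"
    and lim: "limitin weak_topology \<mu> \<mu>0 sequentially"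
    and conv: "(\<lambda>n. \<integral>x. \<psi> x \<partial>\<mu> n) \<longlonglongrightarrow> (\<integral>x. \<psi> x \<partial>\<mu>0)"
    and "\<epsilon> > 0"
  obtains a where "a > 0" "\<And>n. tail_integral \<psi> a (\<mu> n) \<le> \<epsilon>"
proof -
  \<comment> \<open>A quarter leaves room for a strict bound \<open>\<epsilon> / 2\<close> on the
    excess, which the factor two of \<open>tail_integral_le_excess\<close> turns into
    \<open>\<epsilon>\<close>.\<close>
  have "\<epsilon> / 4 > 0" using \<open>\<epsilon> > 0\<close> by simp
  then obtain a where a: "a > 0" "tail_integral \<psi> a \<mu>0 \<le> \<epsilon> / 4"
    using tail_integral_small[OF gauge \<mu>0] by blast
  define excess where "excess \<nu> = (\<integral>x. \<psi> x \<partial>\<nu>) - (\<integral>x. min (\<psi> x) a \<partial>\<nu>)" for \<nu>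
  have "(\<lambda>n. excess (\<mu> n)) \<longlonglongrightarrow> excess \<mu>0"
    unfolding excess_def
  proof (intro tendsto_diff conv limitin_weak_topology_integral[OF lim])
    show "continuous_on UNIV (\<lambda>x. min (\<psi> x) a)"
      using gauge by (intro continuous_intros) (auto simp: gauge_function_def)
    show "bounded (range (\<lambda>x. min (\<psi> x) a))"
      using gauge a(1) unfolding bounded_iff by (intro exI[of _ a]) (auto simp: gauge_function_def)
  qed
  moreover have "excess \<mu>0 < \<epsilon> / 2"
    using tail_integral_le_excess(2)[OF gauge \<mu>0 a(1)] a(2) \<open>\<epsilon> > 0\<close> unfolding excess_def by linarith
  ultimately have "\<forall>\<^sub>F n in sequentially. excess (\<mu> n) < \<epsilon> / 2"
    by (rule order_tendstoD(2))
  then obtain N where N: "\<And>n. N \<le> n \<Longrightarrow> excess (\<mu> n) < \<epsilon> / 2"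
    unfolding eventually_sequentially by auto
  have "\<exists>b>0. tail_integral \<psi> b (\<mu> n) \<le> \<epsilon>" for n
    using tail_integral_small[OF gauge \<mu> \<open>\<epsilon> > 0\<close>] by blast
  then obtain b where b: "\<And>n. tail_integral \<psi> (b n) (\<mu> n) \<le> \<epsilon>"
    by metis
  \<comment> \<open>The entry \<open>2 * a\<close> serves all \<open>n \<ge> N\<close>, makes
    \<open>A\<close> positive and keeps the set nonempty when \<open>N = 0\<close>.\<close>
  define A where "A = Max (insert (2 * a) (b ` {..<N}))"
  have A: "2 * a \<le> A" "\<And>n. n < N \<Longrightarrow> b n \<le> A"
    unfolding A_def by auto
  have "tail_integral \<psi> A (\<mu> n) \<le> \<epsilon>" for n
  proof (cases "n < N")
    case True
    then show ?thesis
      using tail_integral_antimono[OF gauge \<mu> A(2)] b by (meson order_trans)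
  next
    case False
    then have "excess (\<mu> n) < \<epsilon> / 2" using N by simp
    moreover have "tail_integral \<psi> (2 * a) (\<mu> n) \<le> 2 * excess (\<mu> n)"
      unfolding excess_def by (rule tail_integral_le_excess(1)[OF gauge \<mu> a(1)])
    ultimately have "tail_integral \<psi> (2 * a) (\<mu> n) \<le> \<epsilon>" by linarith
    then show ?thesis
      using tail_integral_antimono[OF gauge \<mu> A(1)] by (meson order_trans)
  qed
  moreover have "A > 0" using A(1) a(1) by linarith
  ultimately show ?thesis using that by blast
qed

section \<open>Weak continuity of integrals under locally small tails\<close>

lemma continuous_map_real_locally:
  fixes \<phi> :: "'b \<Rightarrow> real"
  assumes "\<And>x \<epsilon>. x \<in> topspace X \<Longrightarrow> \<epsilon> > 0 \<Longrightarrow>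
    \<exists>U. openin X U \<and> x \<in> U \<and> (\<forall>y\<in>U. \<bar>\<phi> y - \<phi> x\<bar> < \<epsilon>)"
  shows "continuous_map X euclidean \<phi>"
  unfolding continuous_map_def
proof (intro conjI allI impI)
  fix V :: "real set" assume "openin euclidean V"
  then have V: "open V" by simp
  show "openin X {x \<in> topspace X. \<phi> x \<in> V}"
  proof (subst openin_subopen, intro ballI)
    fix x assume "x \<in> {x \<in> topspace X. \<phi> x \<in> V}"
    then have x: "x \<in> topspace X" "\<phi> x \<in> V" by auto
    then obtain \<epsilon> where \<epsilon>: "\<epsilon> > 0" "\<And>r. \<bar>r - \<phi> x\<bar> < \<epsilon> \<Longrightarrow> r \<in> V"
      using V unfolding open_real by blast
    from assms[OF x(1) \<epsilon>(1)] obtain U where U: "openin X U" "x \<in> U"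
      "\<forall>y\<in>U. \<bar>\<phi> y - \<phi> x\<bar> < \<epsilon>"
      by (elim exE conjE)
    then have "U \<subseteq> {x \<in> topspace X. \<phi> x \<in> V}"
      using \<epsilon>(2) openin_subset[OF U(1)] by auto
    then show "\<exists>T. openin X T \<and> x \<in> T \<and> T \<subseteq> {x \<in> topspace X. \<phi> x \<in> V}"
      using U by blast
  qed
qed simp

text \<open>A three-epsilon argument: \<open>f\<close> is replaced by a bounded truncation
  \<open>g\<close> with an error that is uniform over \<open>M \<inter> U\<close>, and the integral
  of \<open>g\<close> is weakly continuous.\<close>

lemma continuous_map_weak_subtopology_gauge:
  fixes \<psi> f :: "'a::topological_space \<Rightarrow> real"
  assumes gauge: "gauge_function \<psi>"
    and M: "M \<subseteq> prob_measures" "\<And>\<mu>. \<mu> \<in> M \<Longrightarrow> integrable \<mu> \<psi>"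
    and loc: "\<And>\<mu> \<epsilon>. \<mu> \<in> M \<Longrightarrow> \<epsilon> > 0 \<Longrightarrow> \<exists>a>0. \<exists>U. openin weak_topology U \<and> \<mu> \<in> U \<and>
      (\<forall>\<nu>\<in>M \<inter> U. tail_integral \<psi> a \<nu> \<le> \<epsilon>)"
    and f: "f \<in> cont_gauge_bounded \<psi>"
  shows "continuous_map (subtopology weak_topology M) euclidean (\<lambda>\<mu>. \<integral>x. f x \<partial>\<mu>)"
proof (rule continuous_map_real_locally)
  from f obtain c where f_cont: "continuous_on UNIV f" and quot: "\<And>x. \<bar>f x / (1 + \<psi> x)\<bar> \<le> c"
    unfolding cont_gauge_bounded_def bdd_above_def by auto
  have pos: "0 < 1 + \<psi> x" for x
    using gauge by (simp add: gauge_function_def add_pos_nonneg)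
  have c: "\<bar>f x\<bar> \<le> c * (1 + \<psi> x)" for x
    using quot[of x] unfolding abs_divide abs_of_pos[OF pos] pos_divide_le_eq[OF pos] .
  \<comment> \<open>The maximum makes the constant positive, so that one may divide by it.\<close>
  define C where "C = max c 1"
  have C0: "C > 0" by (simp add: C_def)
  have fC: "\<bar>f x\<bar> \<le> C * (1 + \<psi> x)" for x
  proof -
    have "c * (1 + \<psi> x) \<le> C * (1 + \<psi> x)"
      using less_imp_le[OF pos[of x]] by (intro mult_right_mono) (simp_all add: C_def)
    with c[of x] show ?thesis by linarith
  qed
  fix \<mu> and \<epsilon> :: real
  assume "\<mu> \<in> topspace (subtopology weak_topology M)" and \<epsilon>: "\<epsilon> > 0"
  then have \<mu>: "\<mu> \<in> M" by simp
  \<comment> \<open>The factor \<open>2 * C\<close> in \<open>truncation_error\<close> turns this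
    tail bound into \<open>\<epsilon> / 3\<close>.\<close>
  have "\<epsilon> / (6 * C) > 0" using \<epsilon> C0 by simp
  from loc[OF \<mu> this] obtain a0 U where U: "openin weak_topology U" "\<mu> \<in> U"
      and "\<forall>\<nu>\<in>M \<inter> U. tail_integral \<psi> a0 \<nu> \<le> \<epsilon> / (6 * C)"
    by (elim exE conjE)
  then have small: "tail_integral \<psi> a0 \<nu> \<le> \<epsilon> / (6 * C)" if "\<nu> \<in> M \<inter> U" for \<nu>
    using that by simp
  \<comment> \<open>\<open>truncation_error\<close> needs a level of at least one; raising the level
    only shrinks the tail.\<close>
  define a where "a = max a0 1"
  define g where "g = (\<lambda>x. max (- (C * (1 + a))) (min (C * (1 + a)) (f x)))"
  have err: "\<bar>(\<integral>x. f x \<partial>\<nu>) - (\<integral>x. g x \<partial>\<nu>)\<bar> \<le> \<epsilon> / 3" if "\<nu> \<in> M \<inter> U" for \<nu>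
  proof -
    have \<nu>: "\<nu> \<in> prob_measures" "integrable \<nu> \<psi>" using that M by auto
    have "\<bar>(\<integral>x. f x \<partial>\<nu>) - (\<integral>x. g x \<partial>\<nu>)\<bar> \<le> 2 * C * tail_integral \<psi> a \<nu>"
      unfolding g_def
      by (intro truncation_error[OF gauge \<nu> f_cont fC]) (use C0 in \<open>simp_all add: a_def\<close>)
    also have "\<dots> \<le> 2 * C * (\<epsilon> / (6 * C))"
    proof (rule mult_left_mono)
      have "tail_integral \<psi> a \<nu> \<le> tail_integral \<psi> a0 \<nu>"
        by (rule tail_integral_antimono[OF gauge \<nu>]) (simp add: a_def)
      with small[OF that] show "tail_integral \<psi> a \<nu> \<le> \<epsilon> / (6 * C)" by linarith
    qed (use C0 in simp)
    finally show ?thesis using C0 by (simp add: field_simps)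
  qed
  define W where "W = {\<nu> \<in> prob_measures. (\<integral>x. g x \<partial>\<nu>) \<in> ball (\<integral>x. g x \<partial>\<mu>) (\<epsilon> / 3)}"
  have g_cont: "continuous_on UNIV g"
    unfolding g_def by (intro continuous_intros f_cont)
  have "0 \<le> C * (1 + a)" using C0 by (simp add: a_def)
  then have "\<bar>g x\<bar> \<le> C * (1 + a)" for x
    unfolding g_def by linarith
  then have g_bdd: "bounded (range g)"
    unfolding bounded_iff by auto
  have W: "openin weak_topology W"
    unfolding W_def by (rule openin_weak_topology[OF g_cont g_bdd]) simp
  have "openin (subtopology weak_topology M) ((U \<inter> W) \<inter> M)"
    unfolding openin_subtopology using openin_Int[OF U(1) W] by blast
  moreover have "\<mu> \<in> (U \<inter> W) \<inter> M"
    using \<mu> M(1) U(2) \<epsilon> unfolding W_def by auto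
  moreover have "\<bar>(\<integral>x. f x \<partial>\<nu>) - (\<integral>x. f x \<partial>\<mu>)\<bar> < \<epsilon>" if "\<nu> \<in> (U \<inter> W) \<inter> M" for \<nu>
  proof -
    have "\<bar>(\<integral>x. g x \<partial>\<mu>) - (\<integral>x. g x \<partial>\<nu>)\<bar> < \<epsilon> / 3"
      using that by (simp add: W_def dist_real_def)
    moreover have "\<bar>(\<integral>x. f x \<partial>\<nu>) - (\<integral>x. g x \<partial>\<nu>)\<bar> \<le> \<epsilon> / 3"
      using that by (intro err) auto
    moreover have "\<bar>(\<integral>x. f x \<partial>\<mu>) - (\<integral>x. g x \<partial>\<mu>)\<bar> \<le> \<epsilon> / 3"
      using \<mu> U(2) by (intro err) auto
    ultimately show ?thesis by linarith
  qed
  ultimately show "\<exists>V. openin (subtopology weak_topology M) V \<and> \<mu> \<in> V \<and>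
      (\<forall>\<nu>\<in>V. \<bar>(\<integral>x. f x \<partial>\<nu>) - (\<integral>x. f x \<partial>\<mu>)\<bar> < \<epsilon>)"
    by blast
qed

section \<open>Test functions of gauge growth\<close>

lemma gauge_in_cont_gauge_bounded:
  assumes "gauge_function \<psi>"
  shows "\<psi> \<in> cont_gauge_bounded \<psi>"
proof -
  have "\<bar>\<psi> x / (1 + \<psi> x)\<bar> \<le> 1" for x
  proof -
    have "0 \<le> \<psi> x" using assms by (simp add: gauge_function_def)
    then show ?thesis by simp
  qed
  then show ?thesis
    using assms unfolding cont_gauge_bounded_def gauge_function_def bdd_above_def by auto
qed

lemma bounded_in_cont_gauge_bounded:
  assumes "gauge_function \<psi>" "continuous_on UNIV f" "bounded (range f)"
  shows "f \<in> cont_gauge_bounded \<psi>"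
proof -
  from assms(3) obtain B where B: "\<And>x. \<bar>f x\<bar> \<le> B" unfolding bounded_iff by auto
  have "\<bar>f x / (1 + \<psi> x)\<bar> \<le> B" for x
  proof -
    have "0 \<le> \<psi> x" using assms(1) by (simp add: gauge_function_def)
    then have "\<bar>f x / (1 + \<psi> x)\<bar> \<le> \<bar>f x\<bar> / 1"
      unfolding abs_divide by (intro divide_left_mono) auto
    with B[of x] show ?thesis by simp
  qed
  then show ?thesis
    using assms(2) unfolding cont_gauge_bounded_def bdd_above_def by auto
qed

subsection \<open>Integrating sets of measures\<close>

lemma prob_measures_gauge_subset: "prob_measures_gauge \<psi> \<subseteq> prob_measures"
  by (auto simp: prob_measures_gauge_def)

lemma uniformly_integrating_subset:
  assumes "uniformly_integrating \<psi> N" "M \<subseteq> N"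
  shows "uniformly_integrating \<psi> M"
  using assms unfolding uniformly_integrating_def SUP_le_iff by (meson subsetD)

text \<open>Gauges are integrable for \<open>\<mu>\<close>, so the tail is finite and equals its
  real counterpart; for positive \<open>\<epsilon>\<close> the embedding \<open>ennreal\<close>
  reflects the inequality.\<close>

lemma tail_integral_le_iff:
  assumes "\<And>k. gauge_function (\<psi> k)" "\<mu> \<in> prob_measures_gauge \<psi>" "\<epsilon> > 0"
  shows "(\<integral>\<^sup>+x. ennreal (\<psi> k x) * indicator {y. a \<le> \<psi> k y} x \<partial>\<mu>) \<le> ennreal \<epsilon>
    \<longleftrightarrow> tail_integral (\<psi> k) a \<mu> \<le> \<epsilon>"
proof -
  have "\<mu> \<in> prob_measures" using assms(2) by (simp add: prob_measures_gauge_def)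
  then show ?thesis
    using nn_tail_integral[OF assms(1) _ integrable_gauge[of \<psi> k, OF assms(1,2)]] assms(3)
    by simp
qed

lemma uniformly_integrating_iff:
  assumes gauge: "\<And>k. gauge_function (\<psi> k)" and M: "M \<subseteq> prob_measures_gauge \<psi>"
  shows "uniformly_integrating \<psi> M \<longleftrightarrow>
    (\<forall>\<epsilon>>0. \<forall>k. \<exists>a>0. \<forall>\<mu>\<in>M. tail_integral (\<psi> k) a \<mu> \<le> \<epsilon>)"
  using tail_integral_le_iff[OF gauge subsetD[OF M]]
  unfolding uniformly_integrating_def SUP_le_iff by (simp cong: conj_cong ball_cong)

lemma locally_uniformly_integrating_iff:
  assumes gauge: "\<And>k. gauge_function (\<psi> k)" and M: "M \<subseteq> prob_measures_gauge \<psi>"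
  shows "locally_uniformly_integrating \<psi> M \<longleftrightarrow>
    (\<forall>\<mu>\<in>M. \<forall>\<epsilon>>0. \<forall>k. \<exists>a>0. \<exists>U. openin weak_topology U \<and> \<mu> \<in> U \<and>
      (\<forall>\<nu>\<in>M \<inter> U. tail_integral (\<psi> k) a \<nu> \<le> \<epsilon>))"
proof -
  have "(\<forall>\<nu>\<in>M \<inter> U. (\<integral>\<^sup>+x. ennreal (\<psi> k x) * indicator {y. a \<le> \<psi> k y} x \<partial>\<nu>) \<le> ennreal \<epsilon>)
      \<longleftrightarrow> (\<forall>\<nu>\<in>M \<inter> U. tail_integral (\<psi> k) a \<nu> \<le> \<epsilon>)" if "\<epsilon> > 0" for U k a \<epsilon>
    using tail_integral_le_iff[OF gauge subsetD[OF M] that] by (intro ball_cong) auto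
  then show ?thesis
    unfolding locally_uniformly_integrating_def by (simp cong: conj_cong)
qed

text \<open>Continuity of the identity in each direction makes each topology finer than the other.
  Full spaces serve as codomains because the image stays in \<open>M\<close>.\<close>

lemma subtopology_eqI:
  assumes "M \<subseteq> topspace X" "M \<subseteq> topspace Y"
    and "continuous_map (subtopology X M) Y id" "continuous_map (subtopology Y M) X id"
  shows "subtopology X M = subtopology Y M"
proof -
  have top: "topspace (subtopology X M) = topspace (subtopology Y M)"
    using assms(1,2) by auto
  have "continuous_map (subtopology X M) (subtopology Y M) id"
    "continuous_map (subtopology Y M) (subtopology X M) id"
    using assms by (auto intro: continuous_map_into_subtopology)
  then show ?thesis
    unfolding topology_eq topology_finer_continuous_id[OF top, symmetric]
      topology_finer_continuous_id[OF top[symmetric], symmetric] by blast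
qed

section \<open>Equivalence of the five conditions\<close>

theorem theorem2p3:
  fixes \<psi> :: "nat \<Rightarrow> 'a::polish_space \<Rightarrow> real"
    and M :: "'a measure set"
  assumes gauge: "\<And>k. gauge_function (\<psi> k)"
    and M: "M \<subseteq> prob_measures_gauge \<psi>"
  defines "a \<equiv> subtopology (gauge_weak_topology \<psi>) M = subtopology weak_topology M"
    and "b \<equiv> locally_uniformly_integrating \<psi> M"
    and "c \<equiv> \<forall>K. K \<subseteq> M \<and> compactin weak_topology K \<longrightarrow> uniformly_integrating \<psi> K"
    and "d \<equiv> \<forall>(\<mu> :: nat \<Rightarrow> 'a measure) \<mu>0.
               range \<mu> \<subseteq> M \<and> \<mu>0 \<in> M \<and> limitin weak_topology \<mu> \<mu>0 sequentially
               \<longrightarrow> uniformly_integrating \<psi> (range \<mu>)"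
    and "e \<equiv> \<forall>(\<mu> :: nat \<Rightarrow> 'a measure) \<mu>0.
               range \<mu> \<subseteq> M \<and> \<mu>0 \<in> M \<and> limitin weak_topology \<mu> \<mu>0 sequentially
               \<longrightarrow> (\<forall>k. (\<lambda>n. \<integral>x. \<psi> k x \<partial>\<mu> n) \<longlonglongrightarrow> (\<integral>x. \<psi> k x \<partial>\<mu>0))"
  shows "(a \<longleftrightarrow> b) \<and> (b \<longleftrightarrow> c) \<and> (c \<longleftrightarrow> d) \<and> (d \<longleftrightarrow> e)"
proof -
  note UI = uniformly_integrating_iff[OF gauge]
  note LUI = locally_uniformly_integrating_iff[OF gauge M]
  have M_prob: "\<mu> \<in> prob_measures" if "\<mu> \<in> M" for \<mu>
    using that M prob_measures_gauge_subset by blast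
  have M_int: "integrable \<mu> (\<psi> k)" if "\<mu> \<in> M" for \<mu> k
    using integrable_gauge[of \<psi> k, OF gauge] that M by blast
  \<comment> \<open>The implications form the cycle \<open>a\<close>, \<open>e\<close>,
    \<open>d\<close>, \<open>b\<close>, \<open>a\<close>, and \<open>c\<close> is inserted between
    \<open>b\<close> and \<open>d\<close>.\<close>
  have "a \<Longrightarrow> e"
    unfolding a_def e_def
  proof (intro allI impI, elim conjE)
    fix \<mu> :: "nat \<Rightarrow> 'a measure" and \<mu>0 k
    assume eq: "subtopology (gauge_weak_topology \<psi>) M = subtopology weak_topology M"
      and \<mu>: "range \<mu> \<subseteq> M" "\<mu>0 \<in> M" "limitin weak_topology \<mu> \<mu>0 sequentially"
    \<comment> \<open>The sequence and its limit lie in \<open>M\<close>, so weak convergence can be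
      read in the common relative topology.\<close>
    then have "limitin (subtopology (gauge_weak_topology \<psi>) M) \<mu> \<mu>0 sequentially"
      unfolding eq limitin_subtopology by (auto intro: always_eventually)
    then have lim: "limitin (gauge_weak_topology \<psi>) \<mu> \<mu>0 sequentially"
      unfolding limitin_subtopology by blast
    have "continuous_map (gauge_weak_topology \<psi>) euclidean (\<lambda>\<nu>. \<integral>x. \<psi> k x \<partial>\<nu>)"
      unfolding gauge_weak_topology_def
      by (rule continuous_map_coarsest_topology) (use gauge_in_cont_gauge_bounded[OF gauge] in blast)
    from continuous_map_limit[OF this lim]
    show "(\<lambda>n. \<integral>x. \<psi> k x \<partial>\<mu> n) \<longlonglongrightarrow> (\<integral>x. \<psi> k x \<partial>\<mu>0)"
      by (simp add: o_def)
  qed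
  moreover have "e \<Longrightarrow> d"
    unfolding d_def
  proof (intro allI impI, elim conjE)
    fix \<mu> :: "nat \<Rightarrow> 'a measure" and \<mu>0
    assume e and \<mu>: "range \<mu> \<subseteq> M" "\<mu>0 \<in> M" "limitin weak_topology \<mu> \<mu>0 sequentially"
    then have conv: "(\<lambda>n. \<integral>x. \<psi> k x \<partial>\<mu> n) \<longlonglongrightarrow> (\<integral>x. \<psi> k x \<partial>\<mu>0)" for k
      unfolding e_def by blast
    have \<mu>M: "\<mu> n \<in> M" for n using \<mu>(1) by blast
    have "\<exists>r>0. \<forall>n. tail_integral (\<psi> k) r (\<mu> n) \<le> \<epsilon>" if "\<epsilon> > 0" for \<epsilon> k
      by (rule tail_integral_uniformly_small[OF gauge M_prob[OF \<mu>M] M_int[OF \<mu>M]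
            M_prob[OF \<mu>(2)] M_int[OF \<mu>(2)] \<mu>(3) conv that]) blast
    moreover have "range \<mu> \<subseteq> prob_measures_gauge \<psi>" using \<mu>(1) M by blast
    ultimately show "uniformly_integrating \<psi> (range \<mu>)"
      by (simp add: UI)
  qed
  moreover have "d \<Longrightarrow> b"
    unfolding b_def LUI
  proof (intro ballI allI impI, rule ccontr)
    fix \<mu> k and \<epsilon> :: real
    assume d and \<mu>: "\<mu> \<in> M" and "\<epsilon> > 0"
      and neg: "\<not> (\<exists>r>0. \<exists>U. openin weak_topology U \<and> \<mu> \<in> U \<and>
        (\<forall>\<nu>\<in>M \<inter> U. tail_integral (\<psi> k) r \<nu> \<le> \<epsilon>))"
    obtain U where U: "\<And>n. openin weak_topology (U n)" "\<And>n. \<mu> \<in> U n"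
      and U_lim: "\<And>\<nu>. (\<And>n::nat. \<nu> n \<in> U n) \<Longrightarrow> limitin weak_topology \<nu> \<mu> sequentially"
      using weak_topology_sequential_base[OF M_prob[OF \<mu>]] by blast
    \<comment> \<open>The positive level \<open>n + 1\<close> and \<open>U n\<close> cannot witness
      local smallness. The chosen measures converge weakly to \<open>\<mu>\<close>, yet their tails
      exceed \<open>\<epsilon>\<close> at levels that outgrow any common \<open>r\<close>.\<close>
    have "\<exists>\<nu>\<in>M \<inter> U n. \<not> tail_integral (\<psi> k) (real (Suc n)) \<nu> \<le> \<epsilon>" for n
    proof (rule ccontr)
      assume "\<not> ?thesis"
      with U[of n] have "openin weak_topology (U n) \<and> \<mu> \<in> U n \<and>
          (\<forall>\<nu>\<in>M \<inter> U n. tail_integral (\<psi> k) (real (Suc n)) \<nu> \<le> \<epsilon>)" by blast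
      with neg of_nat_0_less_iff zero_less_Suc show False by blast
    qed
    then obtain \<nu> where \<nu>: "\<And>n. \<nu> n \<in> M" "\<And>n. \<nu> n \<in> U n"
      and large: "\<And>n. \<not> tail_integral (\<psi> k) (real (Suc n)) (\<nu> n) \<le> \<epsilon>"
      by (metis IntD1 IntD2)
    have "limitin weak_topology \<nu> \<mu> sequentially"
      using \<nu>(2) by (rule U_lim)
    moreover have "range \<nu> \<subseteq> M" using \<nu>(1) by blast
    ultimately have "uniformly_integrating \<psi> (range \<nu>)"
      using \<open>d\<close> \<mu> unfolding d_def by blast
    moreover have "range \<nu> \<subseteq> prob_measures_gauge \<psi>" using \<nu>(1) M by blast
    ultimately have "\<exists>r>0. \<forall>\<rho>\<in>range \<nu>. tail_integral (\<psi> k) r \<rho> \<le> \<epsilon>"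
      by (intro iffD1[OF UI, rule_format] \<open>\<epsilon> > 0\<close>)
    then obtain r where "\<forall>\<rho>\<in>range \<nu>. tail_integral (\<psi> k) r \<rho> \<le> \<epsilon>" by (elim exE conjE)
    then have r: "tail_integral (\<psi> k) r (\<nu> n) \<le> \<epsilon>" for n by simp
    obtain n where "r < real n" using reals_Archimedean2 by blast
    then have "tail_integral (\<psi> k) (real (Suc n)) (\<nu> n) \<le> tail_integral (\<psi> k) r (\<nu> n)"
      using \<nu>(1) by (intro tail_integral_antimono[OF gauge] M_prob M_int) simp_all
    with r[of n] large[of n] show False by linarith
  qed
  moreover have "b \<Longrightarrow> a"
    unfolding a_def
  proof (rule subtopology_eqI)
    assume b
    show "M \<subseteq> topspace (gauge_weak_topology \<psi>)"
      using M by (simp add: gauge_weak_topology_def topspace_coarsest_topology)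
    show "M \<subseteq> topspace weak_topology"
      using M_prob by (auto simp: topspace_weak_topology)
    \<comment> \<open>Bounded continuous functions have gauge growth, which settles this direction;
      only the reverse one draws on \<open>b\<close>.\<close>
    show "continuous_map (subtopology (gauge_weak_topology \<psi>) M) weak_topology id"
      unfolding weak_topology_def
    proof (rule continuous_map_into_coarsest_topology)
      fix \<phi> :: "'a measure \<Rightarrow> real"
      assume "\<phi> \<in> {\<lambda>\<mu>. \<integral>x. f x \<partial>\<mu> | f. continuous_on UNIV f \<and> bounded (range f)}"
      then have "\<phi> \<in> {\<lambda>\<mu>. \<integral>x. f x \<partial>\<mu> | f k. f \<in> cont_gauge_bounded (\<psi> k)}"
        using bounded_in_cont_gauge_bounded[OF gauge] by blast
      then show "continuous_map (subtopology (gauge_weak_topology \<psi>) M) euclidean (\<lambda>x. \<phi> (id x))"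
        unfolding gauge_weak_topology_def
        by (auto intro!: continuous_map_from_subtopology continuous_map_coarsest_topology)
    qed (use M_prob in auto)
    show "continuous_map (subtopology weak_topology M) (gauge_weak_topology \<psi>) id"
      unfolding gauge_weak_topology_def
    proof (rule continuous_map_into_coarsest_topology)
      fix \<phi> :: "'a measure \<Rightarrow> real"
      assume "\<phi> \<in> {\<lambda>\<mu>. \<integral>x. f x \<partial>\<mu> | f k. f \<in> cont_gauge_bounded (\<psi> k)}"
      then obtain f k where \<phi>: "\<phi> = (\<lambda>\<mu>. \<integral>x. f x \<partial>\<mu>)" and f: "f \<in> cont_gauge_bounded (\<psi> k)"
        by blast
      have "continuous_map (subtopology weak_topology M) euclidean (\<lambda>\<mu>. \<integral>x. f x \<partial>\<mu>)"
        using \<open>b\<close> unfolding b_def LUI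
        by (intro continuous_map_weak_subtopology_gauge[OF gauge _ _ _ f] subsetI M_prob M_int) auto
      then show "continuous_map (subtopology weak_topology M) euclidean (\<lambda>x. \<phi> (id x))"
        by (simp add: \<phi>)
    qed (use M in auto)
  qed
  moreover have "b \<Longrightarrow> c"
    unfolding c_def
  proof (intro allI impI, elim conjE)
    fix K assume b and K: "K \<subseteq> M" "compactin weak_topology K"
    have "\<exists>r>0. \<forall>\<mu>\<in>K. tail_integral (\<psi> k) r \<mu> \<le> \<epsilon>" if "\<epsilon> > 0" for \<epsilon> k
    proof -
      have "\<forall>\<mu>\<in>M. \<exists>r>0. \<exists>U. openin weak_topology U \<and> \<mu> \<in> U \<and>
          (\<forall>\<nu>\<in>M \<inter> U. tail_integral (\<psi> k) r \<nu> \<le> \<epsilon>)"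
        using \<open>b\<close> \<open>\<epsilon> > 0\<close> unfolding b_def LUI by simp
      then obtain A U where AU: "\<forall>\<mu>\<in>M. A \<mu> > 0 \<and> openin weak_topology (U \<mu>) \<and> \<mu> \<in> U \<mu> \<and>
          (\<forall>\<nu>\<in>M \<inter> U \<mu>. tail_integral (\<psi> k) (A \<mu>) \<nu> \<le> \<epsilon>)"
        by metis
      then have U: "\<And>\<mu>. \<mu> \<in> M \<Longrightarrow> openin weak_topology (U \<mu>)" "\<And>\<mu>. \<mu> \<in> M \<Longrightarrow> \<mu> \<in> U \<mu>"
        and A: "\<And>\<mu> \<nu>. \<mu> \<in> M \<Longrightarrow> \<nu> \<in> M \<inter> U \<mu> \<Longrightarrow> tail_integral (\<psi> k) (A \<mu>) \<nu> \<le> \<epsilon>"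
        by simp_all
      \<comment> \<open>Finitely many of the local neighbourhoods cover \<open>K\<close>, and the
        largest of their levels works on all of \<open>K\<close> since tails decrease in the
        level.\<close>
      have "\<exists>F. finite F \<and> F \<subseteq> U ` K \<and> K \<subseteq> \<Union>F"
        by (rule compactinD[OF K(2)]) (use U K(1) in auto)
      then obtain L where L: "finite L" "L \<subseteq> K" "K \<subseteq> \<Union>(U ` L)"
        by (metis finite_subset_image)
      \<comment> \<open>Inserting \<open>1\<close> gives a positive level even when \<open>L\<close>
        is empty.\<close>
      define r where "r = Max (insert 1 (A ` L))"
      have r: "1 \<le> r" "\<And>\<mu>. \<mu> \<in> L \<Longrightarrow> A \<mu> \<le> r"
        using L(1) unfolding r_def by auto
      have "tail_integral (\<psi> k) r \<nu> \<le> \<epsilon>" if "\<nu> \<in> K" for \<nu>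
      proof -
        obtain \<mu> where \<mu>: "\<mu> \<in> L" "\<nu> \<in> U \<mu>" using L(3) \<open>\<nu> \<in> K\<close> by blast
        have \<nu>: "\<nu> \<in> M" using that K(1) by blast
        have "tail_integral (\<psi> k) r \<nu> \<le> tail_integral (\<psi> k) (A \<mu>) \<nu>"
          by (rule tail_integral_antimono[OF gauge M_prob[OF \<nu>] M_int[OF \<nu>] r(2)[OF \<mu>(1)]])
        also have "\<dots> \<le> \<epsilon>" using \<mu> \<nu> L(2) K(1) by (intro A) auto
        finally show ?thesis .
      qed
      moreover have "r > 0" using r(1) by simp
      ultimately show ?thesis by blast
    qed
    moreover have "K \<subseteq> prob_measures_gauge \<psi>" using K(1) M by blast
    ultimately show "uniformly_integrating \<psi> K"
      by (simp add: UI)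
  qed
  moreover have "c \<Longrightarrow> d"
    unfolding d_def
  proof (intro allI impI, elim conjE)
    fix \<mu> :: "nat \<Rightarrow> 'a measure" and \<mu>0
    assume c and \<mu>: "range \<mu> \<subseteq> M" "\<mu>0 \<in> M" "limitin weak_topology \<mu> \<mu>0 sequentially"
    \<comment> \<open>A convergent sequence together with its limit is compact, and it stays inside
      \<open>M\<close> because \<open>\<mu>0\<close> does.\<close>
    have "compactin weak_topology (insert \<mu>0 (range \<mu>))"
      by (rule compactin_sequence_with_limit[OF \<mu>(3)])
        (use \<mu>(1) M_prob in \<open>auto simp: topspace_weak_topology\<close>)
    then have "uniformly_integrating \<psi> (insert \<mu>0 (range \<mu>))"
      using \<open>c\<close> \<mu> unfolding c_def by blast
    then show "uniformly_integrating \<psi> (range \<mu>)"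
      by (rule uniformly_integrating_subset) blast
  qed
  ultimately show ?thesis by blast
qed

end
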